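(* Let $R$ be a ring with unity and let $\mathcal{X}$ be a semibrick of left $R$-modules such that every $X\in\mathcal{X}$ has projective dimension at most one and $\mathcal{X}$ contains no $\mathcal{X}$-divisible objects. Then the $\mathcal{X}$-socle filtration of every module $M\in\mathrm{Filt}(\mathcal{X})$ has finite or countable length.
   Context: A brick is a finitely presented left $R$-module whose endomorphism ring is a division ring. A semibrick is a class $\mathcal{X}$ of pairwise non-isomorphic bricks with $\mathrm{Hom}(X,X')=0$ for distinct $X,X'\in\mathcal{X}$. A module $M$ is $\mathcal{X}$-divisible if $\mathrm{Ext}^1(X,M)=0$ for all $X\in\mathcal{X}$. A filtration of a module $M$ is an ascending chain $(M_\lambda,\lambda\le\mu)$ of submodules ($\mu$ an ordinal) with $M_0=0$, $M_\mu=M$ and $M_\nu=\bigcup_{\lambda<\nu}M_\lambda$ for limit ordinals $\nu\le\mu$. It is an $\mathcal{X}$-filtration if each $M_{\lambda+1}/M_\lambda$ ($\lambda<\mu$) is isomorphic to a module in $\mathcal{X}$. $\mathrm{Filt}(\mathcal{X})$ is the class of modules admitting an $\mathcal{X}$-filtration. For a module $N$ put $\mathrm{soc}_{\mathcal{X}}N=\sum_{X\in\mathcal{X},\,f\in\mathrm{Hom}(X,N)}\mathrm{Im}\,f$. The $\mathcal{X}$-socle filtration $(V_\lambda,\lambda\le\mu)$ of $M\in\mathrm{Filt}(\mathcal{X})$ is defined inductively by $V_0=0$, $V_{\lambda+1}$ the preimage of $\mathrm{soc}_{\mathcal{X}}(M/V_\lambda)$ under $M\to M/V_\lambda$, and $V_\lambda=\bigcup_{\alpha<\lambda}V_\alpha$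 for limit ordinals $\lambda$; its length is the least ordinal $\mu$ with $V_\mu=M$. *)

theory Defs
  imports "HOL-Algebra.Module" "HOL-Algebra.AbelCoset" "HOL-Library.Countable_Set"
begin

section \<open>Left modules over a not necessarily commutative ring\<close>

text \<open>
  The library locale for modules assumes a commutative ring of scalars; only its record type and its
  locale of submodules (which makes no such assumption) are reused here. The fields
  \<open>mult\<close> and \<open>one\<close> that this record inherits from rings are irrelevant.
\<close>

locale left_module = R?: ring R + M?: abelian_group M
  for R :: "('r, 'c) ring_scheme" (structure) and M :: "('r, 'm) module" (structure) +
  assumes smult_closed [simp, intro]:
      "\<lbrakk>a \<in> carrier R; x \<in> carrier M\<rbrakk> \<Longrightarrow> a \<odot>\<^bsub>M\<^esub> x \<in> carrier M"
    and smult_l_distr: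
      "\<lbrakk>a \<in> carrier R; b \<in> carrier R; x \<in> carrier M\<rbrakk> \<Longrightarrow>
        (a \<oplus>\<^bsub>R\<^esub> b) \<odot>\<^bsub>M\<^esub> x = a \<odot>\<^bsub>M\<^esub> x \<oplus>\<^bsub>M\<^esub> b \<odot>\<^bsub>M\<^esub> x"
    and smult_r_distr:
      "\<lbrakk>a \<in> carrier R; x \<in> carrier M; y \<in> carrier M\<rbrakk> \<Longrightarrow>
        a \<odot>\<^bsub>M\<^esub> (x \<oplus>\<^bsub>M\<^esub> y) = a \<odot>\<^bsub>M\<^esub> x \<oplus>\<^bsub>M\<^esub> a \<odot>\<^bsub>M\<^esub> y"
    and smult_assoc1:
      "\<lbrakk>a \<in> carrier R; b \<in> carrier R; x \<in> carrier M\<rbrakk> \<Longrightarrow>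
        (a \<otimes>\<^bsub>R\<^esub> b) \<odot>\<^bsub>M\<^esub> x = a \<odot>\<^bsub>M\<^esub> (b \<odot>\<^bsub>M\<^esub> x)"
    and smult_one [simp]:
      "x \<in> carrier M \<Longrightarrow> \<one>\<^bsub>R\<^esub> \<odot>\<^bsub>M\<^esub> x = x"

definition mod_hom ::
  "('r, 'c) ring_scheme \<Rightarrow> ('r, 'a) module \<Rightarrow> ('r, 'b) module \<Rightarrow> ('a \<Rightarrow> 'b) set" where
  "mod_hom R M N =
     {f \<in> hom (add_monoid M) (add_monoid N).
        \<forall>a\<in>carrier R. \<forall>x\<in>carrier M. f (a \<odot>\<^bsub>M\<^esub> x) = a \<odot>\<^bsub>N\<^esub> f x}"

definition mod_iso ::
  "('r, 'c) ring_scheme \<Rightarrow> ('r, 'a) module \<Rightarrow> ('r, 'b) module \<Rightarrow> bool" where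
  "mod_iso R M N \<longleftrightarrow> (\<exists>f\<in>mod_hom R M N. bij_betw f (carrier M) (carrier N))"

definition mod_span ::
  "('r, 'c) ring_scheme \<Rightarrow> ('r, 'm) module \<Rightarrow> 'm set \<Rightarrow> 'm set" where
  "mod_span R M S = \<Inter>{N. submodule N R M \<and> S \<subseteq> N}"

definition quot_module :: "('r, 'm) module \<Rightarrow> 'm set \<Rightarrow> ('r, 'm set) module" where
  "quot_module M N =
     \<lparr>carrier = a_rcosets\<^bsub>M\<^esub> N, mult = undefined, one = undefined, zero = N,
      add = (\<lambda>A B. A <+>\<^bsub>M\<^esub> B), smult = (\<lambda>a A. \<Union>x\<in>A. N +>\<^bsub>M\<^esub> (a \<odot>\<^bsub>M\<^esub> x))\<rparr>"

text \<open>The free module \<open>R\<^bsup>(I)\<^esup>\<close> of finitely supported families.\<close>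

definition free_module ::
  "('r, 'c) ring_scheme \<Rightarrow> 'i set \<Rightarrow> ('r, 'i \<Rightarrow> 'r) module" where
  "free_module R I =
     \<lparr>carrier = {f. (\<forall>i. f i \<in> carrier R) \<and> {i. f i \<noteq> \<zero>\<^bsub>R\<^esub>} \<subseteq> I \<and> finite {i. f i \<noteq> \<zero>\<^bsub>R\<^esub>}},
      mult = undefined, one = undefined, zero = (\<lambda>i. \<zero>\<^bsub>R\<^esub>),
      add = (\<lambda>f g i. f i \<oplus>\<^bsub>R\<^esub> g i), smult = (\<lambda>a f i. a \<otimes>\<^bsub>R\<^esub> f i)\<rparr>"

definition fin_presented :: "('r, 'c) ring_scheme \<Rightarrow> ('r, 'm) module \<Rightarrow> bool" where
  "fin_presented R M \<longleftrightarrow>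
     (\<exists>(n::nat) p S. p \<in> mod_hom R (free_module R {..<n}) M \<and>
        p ` carrier (free_module R {..<n}) = carrier M \<and>
        finite S \<and> S \<subseteq> carrier (free_module R {..<n}) \<and>
        a_kernel (free_module R {..<n}) M p = mod_span R (free_module R {..<n}) S)"

section \<open>Bricks and semibricks\<close>

definition End_ring :: "('r, 'c) ring_scheme \<Rightarrow> ('r, 'm) module \<Rightarrow> ('m \<Rightarrow> 'm) ring" where
  "End_ring R M =
     \<lparr>carrier = mod_hom R M M \<inter> extensional (carrier M),
      mult = compose (carrier M), one = (\<lambda>x\<in>carrier M. x),
      zero = (\<lambda>x\<in>carrier M. \<zero>\<^bsub>M\<^esub>), add = (\<lambda>f g. \<lambda>x\<in>carrier M. f x \<oplus>\<^bsub>M\<^esub> g x)\<rparr>"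

definition division_ring :: "('a, 'c) ring_scheme \<Rightarrow> bool" where
  "division_ring D \<longleftrightarrow> ring D \<and> Units D = carrier D - {\<zero>\<^bsub>D\<^esub>}"

definition brick :: "('r, 'c) ring_scheme \<Rightarrow> ('r, 'm) module \<Rightarrow> bool" where
  "brick R M \<longleftrightarrow> left_module R M \<and> fin_presented R M \<and> division_ring (End_ring R M)"

text \<open>
  Finitely presented modules have bounded cardinality, so pairwise non-isomorphic ones always form
  a set, and all of them can be realised on one sufficiently large type.
\<close>

definition semibrick :: "('r, 'c) ring_scheme \<Rightarrow> ('r, 'x) module set \<Rightarrow> bool" where
  "semibrick R \<X> \<longleftrightarrow>
     (\<forall>X\<in>\<X>. brick R X) \<and>
     (\<forall>X\<in>\<X>. \<forall>Y\<in>\<X>. X \<noteq> Y \<longrightarrow>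
        \<not> mod_iso R X Y \<and> (\<forall>f\<in>mod_hom R X Y. \<forall>x\<in>carrier X. f x = \<zero>\<^bsub>Y\<^esub>))"

section \<open>Projective dimension at most one\<close>

text \<open>
  Lifting property against epimorphisms. The types of the test modules are large enough for the
  canonical epimorphism from the free module on the underlying set of \<open>P\<close> onto \<open>P\<close>; lifting the
  identity of \<open>P\<close> along it makes \<open>P\<close> a direct summand of a free module, hence yields the lifting
  property against epimorphisms between modules on arbitrary types.
\<close>

definition projective :: "('r, 'c) ring_scheme \<Rightarrow> ('r, 'p) module \<Rightarrow> bool" where
  "projective R P \<longleftrightarrow> left_module R P \<and>
     (\<forall>(N :: ('r, 'p \<Rightarrow> 'r) module) (L :: ('r, 'p) module) g f.
        left_module R N \<and> left_module R L \<and>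
        g \<in> mod_hom R N L \<and> g ` carrier N = carrier L \<and> f \<in> mod_hom R P L \<longrightarrow>
        (\<exists>h\<in>mod_hom R P N. \<forall>x\<in>carrier P. g (h x) = f x))"

text \<open>
  A projective resolution \<open>0 \<rightarrow> P1 \<rightarrow> P0 \<rightarrow> M \<rightarrow> 0\<close>. By Schanuel's lemma, if there is one at all,
  then there is one in which \<open>P0\<close> is the free module on the underlying set of \<open>M\<close> and \<open>P1\<close> is a
  submodule of it, so the types chosen for \<open>P0\<close> and \<open>P1\<close> are no restriction.
\<close>

definition proj_dim_le_one :: "('r, 'c) ring_scheme \<Rightarrow> ('r, 'm) module \<Rightarrow> bool" where
  "proj_dim_le_one R M \<longleftrightarrow>
     (\<exists>(P1 :: ('r, 'm \<Rightarrow> 'r) module) (P0 :: ('r, 'm \<Rightarrow> 'r) module) i p.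
        projective R P1 \<and> projective R P0 \<and>
        i \<in> mod_hom R P1 P0 \<and> p \<in> mod_hom R P0 M \<and>
        inj_on i (carrier P1) \<and> i ` carrier P1 = a_kernel P0 M p \<and>
        p ` carrier P0 = carrier M)"

section \<open>Ext and divisible modules\<close>

definition hom_group ::
  "('r, 'c) ring_scheme \<Rightarrow> ('r, 'a) module \<Rightarrow> ('r, 'b) module \<Rightarrow> ('a \<Rightarrow> 'b) monoid" where
  "hom_group R M N =
     \<lparr>carrier = mod_hom R M N \<inter> extensional (carrier M),
      mult = (\<lambda>f g. \<lambda>x\<in>carrier M. f x \<oplus>\<^bsub>N\<^esub> g x), one = (\<lambda>x\<in>carrier M. \<zero>\<^bsub>N\<^esub>)\<rparr>"

text \<open>For \<open>I \<subseteq> carrier M\<close>, the homomorphism \<open>R\<^bsup>(I)\<^esup> \<rightarrow> M\<close> sending each basis element to itself.\<close>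

definition lin_comb :: "('r, 'c) ring_scheme \<Rightarrow> ('r, 'm) module \<Rightarrow> ('m \<Rightarrow> 'r) \<Rightarrow> 'm" where
  "lin_comb R M f = (\<Oplus>\<^bsub>M\<^esub>x\<in>{x. f x \<noteq> \<zero>\<^bsub>R\<^esub>}. f x \<odot>\<^bsub>M\<^esub> x)"

text \<open>
  The first cohomology group of the complex \<open>Hom(F0, N) \<rightarrow> Hom(F1, N) \<rightarrow> Hom(F2, N)\<close>, where
  \<open>F2 \<rightarrow> F1 \<rightarrow> F0 \<rightarrow> M \<rightarrow> 0\<close> is the beginning of the canonical free resolution of \<open>M\<close>.
\<close>

definition Ext1 ::
  "('r, 'c) ring_scheme \<Rightarrow> ('r, 'a) module \<Rightarrow> ('r, 'b) module \<Rightarrow> ((('a \<Rightarrow> 'r) \<Rightarrow> 'r) \<Rightarrow> 'b) set monoid" where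
  "Ext1 R M N =
     (let F0 = free_module R (carrier M);
          F1 = free_module R (a_kernel F0 M (lin_comb R M));
          F2 = free_module R (a_kernel F1 F0 (lin_comb R F0));
          d1 = lin_comb R F0;
          d2 = lin_comb R F1;
          Z = {g \<in> carrier (hom_group R F1 N). \<forall>z\<in>carrier F2. g (d2 z) = \<zero>\<^bsub>N\<^esub>};
          B = (\<lambda>f. compose (carrier F1) f d1) ` carrier (hom_group R F0 N)
      in (hom_group R F1 N)\<lparr>carrier := Z\<rparr> Mod B)"

definition divisible_module ::
  "('r, 'c) ring_scheme \<Rightarrow> ('r, 'x) module set \<Rightarrow> ('r, 'm) module \<Rightarrow> bool" where
  "divisible_module R \<X> M \<longleftrightarrow> (\<forall>X\<in>\<X>. carrier (Ext1 R X M) = {\<one>\<^bsub>Ext1 R X M\<^esub>})"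

section \<open>Filtrations\<close>

text \<open>
  The set of ordinals \<open>\<lambda> \<le> \<mu>\<close> is represented by the field of a well-order \<open>r\<close> with greatest element
  \<open>\<mu>\<close>; the ordinal \<open>\<mu>\<close> itself is the order type of \<open>underS r \<mu>\<close>.
\<close>

definition ordinal_segment :: "'i rel \<Rightarrow> 'i \<Rightarrow> bool" where
  "ordinal_segment r \<mu> \<longleftrightarrow> Well_order r \<and> \<mu> \<in> Field r \<and> (\<forall>a\<in>Field r. (a, \<mu>) \<in> r)"

definition is_zero :: "'i rel \<Rightarrow> 'i \<Rightarrow> bool" where
  "is_zero r a \<longleftrightarrow> a \<in> Field r \<and> underS r a = {}"

definition is_succ :: "'i rel \<Rightarrow> 'i \<Rightarrow> 'i \<Rightarrow> bool" where
  "is_succ r a b \<longleftrightarrow> b \<in> aboveS r a \<and> (\<forall>c\<in>aboveS r a. (b, c) \<in> r)"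

definition is_limit :: "'i rel \<Rightarrow> 'i \<Rightarrow> bool" where
  "is_limit r a \<longleftrightarrow> a \<in> Field r \<and> \<not> is_zero r a \<and> (\<nexists>b. is_succ r b a)"

definition filtration ::
  "('r, 'c) ring_scheme \<Rightarrow> ('r, 'm) module \<Rightarrow> 'i rel \<Rightarrow> 'i \<Rightarrow> ('i \<Rightarrow> 'm set) \<Rightarrow> bool" where
  "filtration R M r \<mu> F \<longleftrightarrow>
     ordinal_segment r \<mu> \<and>
     (\<forall>a\<in>Field r. submodule (F a) R M) \<and>
     (\<forall>a b. (a, b) \<in> r \<longrightarrow> F a \<subseteq> F b) \<and>
     (\<forall>a. is_zero r a \<longrightarrow> F a = {\<zero>\<^bsub>M\<^esub>}) \<and>
     F \<mu> = carrier M \<and>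
     (\<forall>a. is_limit r a \<longrightarrow> F a = (\<Union>b\<in>underS r a. F b))"

definition X_filtration ::
  "('r, 'c) ring_scheme \<Rightarrow> ('r, 'x) module set \<Rightarrow> ('r, 'm) module \<Rightarrow>
   'i rel \<Rightarrow> 'i \<Rightarrow> ('i \<Rightarrow> 'm set) \<Rightarrow> bool" where
  "X_filtration R \<X> M r \<mu> F \<longleftrightarrow>
     filtration R M r \<mu> F \<and>
     (\<forall>a b. is_succ r a b \<longrightarrow> (\<exists>X\<in>\<X>. mod_iso R (quot_module (M\<lparr>carrier := F b\<rparr>) (F a)) X))"

text \<open>
  The type argument only says on which type the ordinals indexing the filtration are represented.
\<close>

definition Filt ::
  "'i itself \<Rightarrow> ('r, 'c) ring_scheme \<Rightarrow> ('r, 'x) module set \<Rightarrow> ('r, 'm) module set" where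
  "Filt I R \<X> = {M. left_module R M \<and> (\<exists>(r :: 'i rel) \<mu> F. X_filtration R \<X> M r \<mu> F)}"

section \<open>The socle filtration\<close>

definition X_socle ::
  "('r, 'c) ring_scheme \<Rightarrow> ('r, 'x) module set \<Rightarrow> ('r, 'm) module \<Rightarrow> 'm set" where
  "X_socle R \<X> N = mod_span R N (\<Union>X\<in>\<X>. \<Union>f\<in>mod_hom R X N. f ` carrier X)"

text \<open>
  The last two conditions say that \<open>\<mu>\<close> is the least ordinal with \<open>V\<^sub>\<mu> = M\<close>, i.e. the length.
\<close>

definition X_socle_filtration ::
  "('r, 'c) ring_scheme \<Rightarrow> ('r, 'x) module set \<Rightarrow> ('r, 'm) module \<Rightarrow>
   'i rel \<Rightarrow> 'i \<Rightarrow> ('i \<Rightarrow> 'm set) \<Rightarrow> bool" where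
  "X_socle_filtration R \<X> M r \<mu> V \<longleftrightarrow>
     ordinal_segment r \<mu> \<and>
     (\<forall>a. is_zero r a \<longrightarrow> V a = {\<zero>\<^bsub>M\<^esub>}) \<and>
     (\<forall>a b. is_succ r a b \<longrightarrow>
        V b = {x \<in> carrier M. V a +>\<^bsub>M\<^esub> x \<in> X_socle R \<X> (quot_module M (V a))}) \<and>
     (\<forall>a. is_limit r a \<longrightarrow> V a = (\<Union>b\<in>underS r a. V b)) \<and>
     V \<mu> = carrier M \<and>
     (\<forall>a\<in>underS r \<mu>. V a \<noteq> carrier M)"

end

theory Submission
  imports Defs
begin

text \<open>
  Write \<open>V\<^sub>\<omega>\<close> for the union of the finite stages \<open>V\<^sub>n\<close> of the socle filtration. By transfinite induction
  every member of an \<open>\<X>\<close>-filtration \<open>F\<close> of \<open>M\<close> is contained in \<open>V\<^sub>\<omega>\<close>, so the socle filtration has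
  length at most \<open>\<omega>\<close>. In the successor step, lift a finite presentation \<open>R\<^sup>n \<rightarrow> X\<close> of
  \<open>F\<^bsub>\<lambda>+1\<^esub> / F\<^sub>\<lambda> \<cong> X\<close> to a map \<open>R\<^sup>n \<rightarrow> F\<^bsub>\<lambda>+1\<^esub>\<close>. It sends the finitely many relations into \<open>F\<^sub>\<lambda>\<close>, hence
  into a single \<open>V\<^sub>m\<close>, and so induces a map \<open>X \<rightarrow> M / V\<^sub>m\<close>; therefore its image lies in \<open>V\<^bsub>m+1\<^esub>\<close>.
\<close>

section \<open>Submodules and quotients\<close>

lemma submodule_zero: "submodule N R M \<Longrightarrow> \<zero>\<^bsub>M\<^esub> \<in> N"
  using subgroup.one_closed[OF submodule.axioms(1), of N R M] by simp

lemma submodule_add: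
  "\<lbrakk>submodule N R M; x \<in> N; y \<in> N\<rbrakk> \<Longrightarrow> x \<oplus>\<^bsub>M\<^esub> y \<in> N"
  using subgroup.m_closed[OF submodule.axioms(1), of N R M] by simp

lemma submodule_subset: "submodule N R M \<Longrightarrow> N \<subseteq> carrier M"
  using subgroup.subset[OF submodule.axioms(1), of N R M] by simp

lemma mod_homD:
  assumes "f \<in> mod_hom R M N"
  shows "x \<in> carrier M \<Longrightarrow> f x \<in> carrier N"
    and "\<lbrakk>x \<in> carrier M; y \<in> carrier M\<rbrakk> \<Longrightarrow> f (x \<oplus>\<^bsub>M\<^esub> y) = f x \<oplus>\<^bsub>N\<^esub> f y"
    and "\<lbrakk>a \<in> carrier R; x \<in> carrier M\<rbrakk> \<Longrightarrow> f (a \<odot>\<^bsub>M\<^esub> x) = a \<odot>\<^bsub>N\<^esub> f x"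
  using assms by (auto simp: mod_hom_def hom_def Pi_iff)

lemma mod_homI:
  assumes "\<And>x. x \<in> carrier M \<Longrightarrow> f x \<in> carrier N"
    and "\<And>x y. \<lbrakk>x \<in> carrier M; y \<in> carrier M\<rbrakk> \<Longrightarrow> f (x \<oplus>\<^bsub>M\<^esub> y) = f x \<oplus>\<^bsub>N\<^esub> f y"
    and "\<And>a x. \<lbrakk>a \<in> carrier R; x \<in> carrier M\<rbrakk> \<Longrightarrow> f (a \<odot>\<^bsub>M\<^esub> x) = a \<odot>\<^bsub>N\<^esub> f x"
  shows "f \<in> mod_hom R M N"
  using assms by (auto simp: mod_hom_def hom_def)

context left_module
begin

lemma smult_zero_left:
  assumes "x \<in> carrier M" shows "\<zero>\<^bsub>R\<^esub> \<odot>\<^bsub>M\<^esub> x = \<zero>\<^bsub>M\<^esub>"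
proof -
  have "\<zero>\<^bsub>R\<^esub> \<odot>\<^bsub>M\<^esub> x \<oplus>\<^bsub>M\<^esub> \<zero>\<^bsub>R\<^esub> \<odot>\<^bsub>M\<^esub> x = \<zero>\<^bsub>R\<^esub> \<odot>\<^bsub>M\<^esub> x"
    using assms smult_l_distr[of "\<zero>\<^bsub>R\<^esub>" "\<zero>\<^bsub>R\<^esub>" x] by simp
  then show ?thesis using assms by (simp add: M.add.l_cancel_one')
qed

lemma smult_zero_right:
  assumes "a \<in> carrier R" shows "a \<odot>\<^bsub>M\<^esub> \<zero>\<^bsub>M\<^esub> = \<zero>\<^bsub>M\<^esub>"
proof -
  have "a \<odot>\<^bsub>M\<^esub> \<zero>\<^bsub>M\<^esub> \<oplus>\<^bsub>M\<^esub> a \<odot>\<^bsub>M\<^esub> \<zero>\<^bsub>M\<^esub> = a \<odot>\<^bsub>M\<^esub> \<zero>\<^bsub>M\<^esub>"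
    using assms smult_r_distr[of a "\<zero>\<^bsub>M\<^esub>" "\<zero>\<^bsub>M\<^esub>"] by simp
  then show ?thesis using assms by (simp add: M.add.l_cancel_one')
qed

text \<open>Negation is scaling by -1. Hence closure under scalars already gives closure under
  negatives, and maps compatible with scalars respect subtraction.\<close>

lemma smult_minus_one:
  assumes "x \<in> carrier M" shows "(\<ominus>\<^bsub>R\<^esub> \<one>\<^bsub>R\<^esub>) \<odot>\<^bsub>M\<^esub> x = \<ominus>\<^bsub>M\<^esub> x"
proof -
  have "(\<ominus>\<^bsub>R\<^esub> \<one>\<^bsub>R\<^esub>) \<odot>\<^bsub>M\<^esub> x \<oplus>\<^bsub>M\<^esub> x = \<zero>\<^bsub>M\<^esub>"
    using assms smult_l_distr[of "\<ominus>\<^bsub>R\<^esub> \<one>\<^bsub>R\<^esub>" "\<one>\<^bsub>R\<^esub>" x]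
    by (simp add: R.l_neg smult_zero_left)
  then show ?thesis using assms by (simp add: M.minus_equality)
qed

lemma submoduleI:
  assumes "H \<subseteq> carrier M" and "\<zero>\<^bsub>M\<^esub> \<in> H"
    and "\<And>x y. \<lbrakk>x \<in> H; y \<in> H\<rbrakk> \<Longrightarrow> x \<oplus>\<^bsub>M\<^esub> y \<in> H"
    and "\<And>a x. \<lbrakk>a \<in> carrier R; x \<in> H\<rbrakk> \<Longrightarrow> a \<odot>\<^bsub>M\<^esub> x \<in> H"
  shows "submodule H R M"
proof (intro submodule.intro subgroup.intro submodule_axioms.intro)
  fix x assume "x \<in> H"
  then have "\<ominus>\<^bsub>M\<^esub> x \<in> H" using assms smult_minus_one[of x] by (metis R.add.inv_closed R.one_closed subsetD)
  then show "inv\<^bsub>add_monoid M\<^esub> x \<in> H" by (simp add: a_inv_def)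
qed (use assms in auto)

lemma submodule_abelian_subgroup:
  "submodule N R M \<Longrightarrow> abelian_subgroup N M"
  using M.abelian_group_axioms
  by (intro abelian_subgroupI3 additive_subgroupI) (auto dest: submodule.axioms(1))

lemma submodule_minus:
  "\<lbrakk>submodule N R M; x \<in> N; y \<in> N\<rbrakk> \<Longrightarrow> x \<ominus>\<^bsub>M\<^esub> y \<in> N"
  using submodule_abelian_subgroup[of N]
  by (simp add: a_minus_def submodule_add abelian_subgroup_def additive_subgroup.a_inv_closed)

lemma rcoset_eq_iff:
  assumes "submodule N R M" "x \<in> carrier M" "y \<in> carrier M"
  shows "N +>\<^bsub>M\<^esub> x = N +>\<^bsub>M\<^esub> y \<longleftrightarrow> x \<ominus>\<^bsub>M\<^esub> y \<in> N"
proof -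
  have sub: "subgroup N (add_monoid M)" using assms(1) by (rule submodule.axioms(1))
  note ss = submodule_subset[OF assms(1)]
  have xy: "x \<ominus>\<^bsub>M\<^esub> y \<in> carrier M" using assms(2,3) by simp
  show ?thesis
  proof
    assume "N +>\<^bsub>M\<^esub> x = N +>\<^bsub>M\<^esub> y"
    then have "N +>\<^bsub>M\<^esub> (x \<ominus>\<^bsub>M\<^esub> y) = N"
      using M.a_coset_add_inv2[OF _ assms(2,3) ss] by (simp only: a_minus_def)
    then show "x \<ominus>\<^bsub>M\<^esub> y \<in> N" using xy sub by (rule M.a_coset_join1)
  next
    assume "x \<ominus>\<^bsub>M\<^esub> y \<in> N"
    then have "N +>\<^bsub>M\<^esub> (x \<ominus>\<^bsub>M\<^esub> y) = N" by (rule M.a_coset_join2[OF xy sub])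
    then show "N +>\<^bsub>M\<^esub> x = N +>\<^bsub>M\<^esub> y"
      using M.a_coset_add_inv1[OF _ assms(2,3) ss] by (simp only: a_minus_def)
  qed
qed

text \<open>The action on cosets in \<open>quot_module\<close> is a union over all representatives.
  It collapses to one coset because changing \<open>x\<close> by \<open>n\<close> in
  \<open>N\<close> changes the product by \<open>a n\<close>, which lies in \<open>N\<close>
  again.\<close>

lemma quot_smult_rcoset:
  assumes N: "submodule N R M" and a: "a \<in> carrier R" and x: "x \<in> carrier M"
  shows "a \<odot>\<^bsub>quot_module M N\<^esub> (N +>\<^bsub>M\<^esub> x) = N +>\<^bsub>M\<^esub> (a \<odot>\<^bsub>M\<^esub> x)"
proof -
  interpret abelian_subgroup N M using N by (rule submodule_abelian_subgroup)
  have "N +>\<^bsub>M\<^esub> (a \<odot>\<^bsub>M\<^esub> y) = N +>\<^bsub>M\<^esub> (a \<odot>\<^bsub>M\<^esub> x)" if y: "y \<in> N +>\<^bsub>M\<^esub> x" for y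
  proof -
    obtain n where n: "n \<in> N" "y = n \<oplus>\<^bsub>M\<^esub> x" using y by (auto simp: a_r_coset_def')
    have nM: "n \<in> carrier M" using n(1) submodule_subset[OF N] by auto
    have "a \<odot>\<^bsub>M\<^esub> y = a \<odot>\<^bsub>M\<^esub> n \<oplus>\<^bsub>M\<^esub> a \<odot>\<^bsub>M\<^esub> x"
      using n(2) nM a x by (simp add: smult_r_distr)
    moreover have "a \<odot>\<^bsub>M\<^esub> n \<in> N" using n(1) a N by (simp add: submodule.smult_closed)
    ultimately have "a \<odot>\<^bsub>M\<^esub> y \<in> N +>\<^bsub>M\<^esub> (a \<odot>\<^bsub>M\<^esub> x)"
      by (auto simp: a_r_coset_def')
    then show ?thesis
      using M.a_repr_independence[OF _ _ a_subgroup] a x by blast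
  qed
  moreover have "x \<in> N +>\<^bsub>M\<^esub> x" using x by (rule a_rcos_self)
  ultimately have "(\<Union>y\<in>N +>\<^bsub>M\<^esub> x. N +>\<^bsub>M\<^esub> (a \<odot>\<^bsub>M\<^esub> y)) = N +>\<^bsub>M\<^esub> (a \<odot>\<^bsub>M\<^esub> x)"
    by blast
  then show ?thesis by (simp add: quot_module_def)
qed

lemma quot_proj_hom:
  assumes N: "submodule N R M"
  shows "(\<lambda>x. N +>\<^bsub>M\<^esub> x) \<in> mod_hom R M (quot_module M N)"
proof (rule mod_homI)
  interpret abelian_subgroup N M using N by (rule submodule_abelian_subgroup)
  show "N +>\<^bsub>M\<^esub> (x \<oplus>\<^bsub>M\<^esub> y) = (N +>\<^bsub>M\<^esub> x) \<oplus>\<^bsub>quot_module M N\<^esub> (N +>\<^bsub>M\<^esub> y)"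
    if "x \<in> carrier M" "y \<in> carrier M" for x y
    using a_rcos_sum[OF that] by (simp add: quot_module_def)
  show "N +>\<^bsub>M\<^esub> x \<in> carrier (quot_module M N)" if "x \<in> carrier M" for x
    using M.a_rcosetsI[OF a_subset that] by (simp add: quot_module_def)
qed (simp add: quot_smult_rcoset N)

lemma submodule_vimage:
  assumes F: "left_module R F" and f: "f \<in> mod_hom R F M" and N: "submodule N R M"
  shows "submodule {x \<in> carrier F. f x \<in> N} R F"
proof -
  interpret F: left_module R F by (rule F)
  have "f \<zero>\<^bsub>F\<^esub> = \<zero>\<^bsub>M\<^esub>"
    using mod_homD(3)[OF f, of "\<zero>\<^bsub>R\<^esub>" "\<zero>\<^bsub>F\<^esub>"] mod_homD(1)[OF f, of "\<zero>\<^bsub>F\<^esub>"]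
    by (simp add: F.smult_zero_left smult_zero_left)
  then show ?thesis
    by (intro F.submoduleI)
      (auto simp: mod_homD[OF f] submodule_zero[OF N] submodule_add[OF N] submodule.smult_closed[OF N])
qed

end

lemma left_module_submodule:
  assumes M: "left_module R M" and B: "submodule B R M"
  shows "left_module R (M\<lparr>carrier := B\<rparr>)"
proof -
  interpret left_module R M by (rule M)
  note ss = subsetD[OF submodule_subset[OF B]]
  show ?thesis
  proof (intro left_module.intro left_module_axioms.intro abelian_groupI)
    show "\<exists>y\<in>carrier (M\<lparr>carrier := B\<rparr>). y \<oplus>\<^bsub>M\<lparr>carrier := B\<rparr>\<^esub> x = \<zero>\<^bsub>M\<lparr>carrier := B\<rparr>\<^esub>"
      if "x \<in> carrier (M\<lparr>carrier := B\<rparr>)" for x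
    proof
      \<comment> \<open>The inverse is written as 0 - x, so that its membership in \<open>B\<close>
        is an instance of \<open>submodule_minus\<close>.\<close>
      show "\<zero>\<^bsub>M\<^esub> \<ominus>\<^bsub>M\<^esub> x \<in> carrier (M\<lparr>carrier := B\<rparr>)"
        using that submodule_minus[OF B submodule_zero[OF B]] by simp
      show "\<zero>\<^bsub>M\<^esub> \<ominus>\<^bsub>M\<^esub> x \<oplus>\<^bsub>M\<lparr>carrier := B\<rparr>\<^esub> x = \<zero>\<^bsub>M\<lparr>carrier := B\<rparr>\<^esub>"
        using that ss by (simp add: a_minus_def M.l_neg)
    qed
    show "x \<oplus>\<^bsub>M\<lparr>carrier := B\<rparr>\<^esub> y = y \<oplus>\<^bsub>M\<lparr>carrier := B\<rparr>\<^esub> x"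
      if "x \<in> carrier (M\<lparr>carrier := B\<rparr>)" "y \<in> carrier (M\<lparr>carrier := B\<rparr>)" for x y
      using M.a_comm[of x y] that ss by simp
  qed (simp_all add: R.ring_axioms ss submodule_zero[OF B] submodule_add[OF B]
      submodule.smult_closed[OF B] smult_l_distr smult_r_distr smult_assoc1 M.a_assoc)
qed

section \<open>Free modules\<close>

lemma free_module_memI:
  assumes "\<And>i. f i \<in> carrier R" "{i. f i \<noteq> \<zero>\<^bsub>R\<^esub>} \<subseteq> J" "J \<subseteq> I" "finite J"
  shows "f \<in> carrier (free_module R I)"
  using assms finite_subset[OF assms(2,4)] by (auto simp: free_module_def)

lemma free_module_memD:
  assumes "f \<in> carrier (free_module R I)"
  shows "f i \<in> carrier R" "{i. f i \<noteq> \<zero>\<^bsub>R\<^esub>} \<subseteq> I" "finite {i. f i \<noteq> \<zero>\<^bsub>R\<^esub>}"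
  using assms by (auto simp: free_module_def)

lemma free_module_simps:
  "(f \<oplus>\<^bsub>free_module R I\<^esub> g) = (\<lambda>i. f i \<oplus>\<^bsub>R\<^esub> g i)"
  "(a \<odot>\<^bsub>free_module R I\<^esub> f) = (\<lambda>i. a \<otimes>\<^bsub>R\<^esub> f i)"
  "\<zero>\<^bsub>free_module R I\<^esub> = (\<lambda>i. \<zero>\<^bsub>R\<^esub>)"
  by (simp_all add: free_module_def)

lemma left_module_free:
  assumes "ring R"
  shows "left_module R (free_module R I)"
proof -
  interpret ring R by (rule assms)
  note D = free_module_memD[of _ R I]
  show ?thesis
  proof (intro left_module.intro left_module_axioms.intro abelian_groupI)
    fix f g assume f: "f \<in> carrier (free_module R I)" and g: "g \<in> carrier (free_module R I)"
    show "f \<oplus>\<^bsub>free_module R I\<^esub> g \<in> carrier (free_module R I)"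
      unfolding free_module_simps
    proof (rule free_module_memI)
      show "{i. f i \<oplus>\<^bsub>R\<^esub> g i \<noteq> \<zero>\<^bsub>R\<^esub>} \<subseteq> {i. f i \<noteq> \<zero>\<^bsub>R\<^esub>} \<union> {i. g i \<noteq> \<zero>\<^bsub>R\<^esub>}"
        by auto
    qed (use D[OF f] D[OF g] in auto)
    show "f \<oplus>\<^bsub>free_module R I\<^esub> g = g \<oplus>\<^bsub>free_module R I\<^esub> f"
      unfolding free_module_simps using D(1)[OF f] D(1)[OF g] by (intro ext a_comm)
  next
    fix f assume f: "f \<in> carrier (free_module R I)"
    show "\<exists>g\<in>carrier (free_module R I). g \<oplus>\<^bsub>free_module R I\<^esub> f = \<zero>\<^bsub>free_module R I\<^esub>"
    proof
      show "(\<lambda>i. \<ominus>\<^bsub>R\<^esub> f i) \<in> carrier (free_module R I)"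
      proof (rule free_module_memI)
        show "{i. \<ominus>\<^bsub>R\<^esub> f i \<noteq> \<zero>\<^bsub>R\<^esub>} \<subseteq> {i. f i \<noteq> \<zero>\<^bsub>R\<^esub>}" by auto
      qed (use D[OF f] in auto)
      show "(\<lambda>i. \<ominus>\<^bsub>R\<^esub> f i) \<oplus>\<^bsub>free_module R I\<^esub> f = \<zero>\<^bsub>free_module R I\<^esub>"
        using D(1)[OF f] by (simp add: free_module_simps l_neg)
    qed
  next
    fix a f assume a: "a \<in> carrier R" and f: "f \<in> carrier (free_module R I)"
    show "a \<odot>\<^bsub>free_module R I\<^esub> f \<in> carrier (free_module R I)"
      unfolding free_module_simps
    proof (rule free_module_memI)
      show "{i. a \<otimes>\<^bsub>R\<^esub> f i \<noteq> \<zero>\<^bsub>R\<^esub>} \<subseteq> {i. f i \<noteq> \<zero>\<^bsub>R\<^esub>}" using a by auto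
    qed (use a D[OF f] in auto)
  next
    show "\<zero>\<^bsub>free_module R I\<^esub> \<in> carrier (free_module R I)"
      unfolding free_module_simps by (rule free_module_memI[of _ _ "{}"]) auto
  qed (auto simp: free_module_simps assms D(1) a_assoc l_distr r_distr m_assoc)
qed

definition unit_vec :: "('r, 'c) ring_scheme \<Rightarrow> 'i \<Rightarrow> 'i \<Rightarrow> 'r" where
  "unit_vec R i = (\<lambda>j. if j = i then \<one>\<^bsub>R\<^esub> else \<zero>\<^bsub>R\<^esub>)"

lemma unit_vec_carrier:
  assumes "ring R" "i \<in> I"
  shows "unit_vec R i \<in> carrier (free_module R I)"
proof -
  interpret ring R by fact
  show ?thesis
    by (rule free_module_memI[of _ _ "{i}"]) (use assms(2) in \<open>auto simp: unit_vec_def\<close>)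
qed

text \<open>Elements have finite support, so they are finite combinations of unit vectors. The
  induction runs over a finite set \<open>J\<close> bounding the support, for all \<open>f\<close>
  at once, and strips one coordinate at a time.\<close>

lemma free_hom_eqI:
  assumes R: "ring R" and L: "left_module R L"
    and p: "p \<in> mod_hom R (free_module R I) L" and q: "q \<in> mod_hom R (free_module R I) L"
    and pq: "\<And>i. i \<in> I \<Longrightarrow> p (unit_vec R i) = q (unit_vec R i)"
    and f: "f \<in> carrier (free_module R I)"
  shows "p f = q f"
proof -
  interpret ring R by (rule R)
  interpret L: left_module R L by (rule L)
  let ?F = "free_module R I"
  interpret F: left_module R ?F by (rule left_module_free[OF R])
  have "\<forall>f\<in>carrier ?F. {i. f i \<noteq> \<zero>\<^bsub>R\<^esub>} \<subseteq> J \<longrightarrow> p f = q f" if "finite J" for J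
    using that
  proof (induction J)
    case empty
    show ?case
    proof (intro ballI impI)
      fix f assume f: "f \<in> carrier ?F" "{i. f i \<noteq> \<zero>\<^bsub>R\<^esub>} \<subseteq> {}"
      \<comment> \<open>A family with empty support is 0 times itself, so both maps send it to 0 by
        compatibility with scalars.\<close>
      then have "f = \<zero>\<^bsub>R\<^esub> \<odot>\<^bsub>?F\<^esub> f" by (auto simp: free_module_def fun_eq_iff)
      then show "p f = q f"
        using f(1) mod_homD(1,3)[OF p] mod_homD(1,3)[OF q] by (metis L.smult_zero_left zero_closed)
    qed
  next
    case (insert k J)
    show ?case
    proof (intro ballI impI)
      fix f assume f: "f \<in> carrier ?F" "{i. f i \<noteq> \<zero>\<^bsub>R\<^esub>} \<subseteq> insert k J"
      show "p f = q f"
      proof (cases "f k = \<zero>\<^bsub>R\<^esub>")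
        case True
        then have "{i. f i \<noteq> \<zero>\<^bsub>R\<^esub>} \<subseteq> J" using f(2) by auto
        then show ?thesis using insert.IH f(1) by blast
      next
        case False
        \<comment> \<open>Erasing coordinate \<open>k\<close> leaves support in \<open>J\<close>;
          the erased part is a multiple of the unit vector at \<open>k\<close>.\<close>
        let ?g = "f(k := \<zero>\<^bsub>R\<^esub>)"
        have k: "k \<in> I" and fk: "f k \<in> carrier R" using False f(1) by (auto simp: free_module_def)
        have g: "?g \<in> carrier ?F"
          by (rule free_module_memI[OF _ _ free_module_memD(2,3)[OF f(1)]])
            (use free_module_memD(1)[OF f(1)] in auto)
        have "{i. ?g i \<noteq> \<zero>\<^bsub>R\<^esub>} \<subseteq> J" using f(2) by auto
        then have IH: "p ?g = q ?g" using insert.IH g by blast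
        have e: "unit_vec R k \<in> carrier ?F" using unit_vec_carrier[OF R k] .
        have "f = ?g \<oplus>\<^bsub>?F\<^esub> f k \<odot>\<^bsub>?F\<^esub> unit_vec R k"
          using f(1) by (auto simp: free_module_def unit_vec_def fun_eq_iff)
        then show ?thesis
          using mod_homD(2,3)[OF p] mod_homD(2,3)[OF q] g e fk IH pq[OF k] F.smult_closed by metis
      qed
    qed
  qed
  moreover have "finite {i. f i \<noteq> \<zero>\<^bsub>R\<^esub>}" using f by (simp add: free_module_def)
  ultimately show ?thesis using f by blast
qed

context left_module
begin

lemma finsum_smult:
  assumes "finite J" "a \<in> carrier R" "m \<in> J \<rightarrow> carrier M"
  shows "(\<Oplus>\<^bsub>M\<^esub>i\<in>J. a \<odot>\<^bsub>M\<^esub> m i) = a \<odot>\<^bsub>M\<^esub> (\<Oplus>\<^bsub>M\<^esub>i\<in>J. m i)"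
  using assms
proof (induction J)
  case empty
  then show ?case by (simp add: smult_zero_right)
next
  case (insert j J)
  have "(\<lambda>i. a \<odot>\<^bsub>M\<^esub> m i) \<in> J \<rightarrow> carrier M" "a \<odot>\<^bsub>M\<^esub> m j \<in> carrier M" "m \<in> J \<rightarrow> carrier M" "m j \<in> carrier M"
    using insert.prems by auto
  with insert show ?case by (simp add: M.finsum_insert smult_r_distr)
qed

text \<open>For finite \<open>I\<close> the linear combination can be summed over all of
  \<open>I\<close> instead of over the support of \<open>g\<close>. The index set is then
  independent of \<open>g\<close>, and additivity is termwise.\<close>

lemma free_hom_exists:
  assumes "finite I" and m: "m \<in> I \<rightarrow> carrier M"
  obtains f where "f \<in> mod_hom R (free_module R I) M"
    and "\<And>i. i \<in> I \<Longrightarrow> f (unit_vec R i) = m i"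
proof
  let ?f = "\<lambda>g. \<Oplus>\<^bsub>M\<^esub>i\<in>I. g i \<odot>\<^bsub>M\<^esub> m i"
  have c: "(\<lambda>i. g i \<odot>\<^bsub>M\<^esub> m i) \<in> I \<rightarrow> carrier M" if "g \<in> carrier (free_module R I)" for g
    using that m by (auto simp: free_module_def)
  show "?f \<in> mod_hom R (free_module R I) M"
  proof (rule mod_homI)
    fix g h assume g: "g \<in> carrier (free_module R I)" and h: "h \<in> carrier (free_module R I)"
    have "?f (g \<oplus>\<^bsub>free_module R I\<^esub> h) = (\<Oplus>\<^bsub>M\<^esub>i\<in>I. g i \<odot>\<^bsub>M\<^esub> m i \<oplus>\<^bsub>M\<^esub> h i \<odot>\<^bsub>M\<^esub> m i)"
      using g h m c[OF g] c[OF h]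
      by (intro M.finsum_cong') (auto simp: free_module_def smult_l_distr Pi_iff)
    also have "\<dots> = ?f g \<oplus>\<^bsub>M\<^esub> ?f h"
      using c[OF g] c[OF h] by (rule M.finsum_addf)
    finally show "?f (g \<oplus>\<^bsub>free_module R I\<^esub> h) = ?f g \<oplus>\<^bsub>M\<^esub> ?f h" .
  next
    fix a g assume a: "a \<in> carrier R" and g: "g \<in> carrier (free_module R I)"
    have "?f (a \<odot>\<^bsub>free_module R I\<^esub> g) = (\<Oplus>\<^bsub>M\<^esub>i\<in>I. a \<odot>\<^bsub>M\<^esub> (g i \<odot>\<^bsub>M\<^esub> m i))"
      using g a m by (intro M.finsum_cong') (auto simp: free_module_def smult_assoc1 Pi_iff)
    also have "\<dots> = a \<odot>\<^bsub>M\<^esub> ?f g"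
      using assms(1) a c[OF g] by (rule finsum_smult)
    finally show "?f (a \<odot>\<^bsub>free_module R I\<^esub> g) = a \<odot>\<^bsub>M\<^esub> ?f g" .
  qed (use c in \<open>simp add: M.finsum_closed\<close>)
  show "?f (unit_vec R i) = m i" if i: "i \<in> I" for i
  proof -
    have "?f (unit_vec R i) = (\<Oplus>\<^bsub>M\<^esub>j\<in>I. if i = j then m j else \<zero>\<^bsub>M\<^esub>)"
      using m by (intro M.finsum_cong') (auto simp: unit_vec_def smult_zero_left Pi_iff)
    then show ?thesis using M.finsum_singleton[OF i assms(1) m] by simp
  qed
qed

end

section \<open>The finite stages of the socle filtration\<close>

text \<open>Plain recursion on \<open>nat\<close> gives the stages without reference to a
  well-order. They are compared later with socle filtrations over arbitrary well-orders by counting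
  predecessors.\<close>

primrec socle_stage ::
  "('r, 'c) ring_scheme \<Rightarrow> ('r, 'x) module set \<Rightarrow> ('r, 'm) module \<Rightarrow> nat \<Rightarrow> 'm set" where
  "socle_stage R \<X> M 0 = {\<zero>\<^bsub>M\<^esub>}"
| "socle_stage R \<X> M (Suc n) =
     {x \<in> carrier M. socle_stage R \<X> M n +>\<^bsub>M\<^esub> x \<in>
        X_socle R \<X> (quot_module M (socle_stage R \<X> M n))}"

text \<open>Each closure property passes to an intersection of submodules. Nothing is assumed about
  \<open>M\<close>, so this applies to \<open>quot_module\<close>, whose module axioms are never
  established here.\<close>

lemma mod_span_closed:
  shows "\<zero>\<^bsub>M\<^esub> \<in> mod_span R M S"
    and "\<lbrakk>x \<in> mod_span R M S; y \<in> mod_span R M S\<rbrakk> \<Longrightarrow> x \<oplus>\<^bsub>M\<^esub> y \<in> mod_span R M S"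
    and "\<lbrakk>a \<in> carrier R; x \<in> mod_span R M S\<rbrakk> \<Longrightarrow> a \<odot>\<^bsub>M\<^esub> x \<in> mod_span R M S"
  by (auto simp: mod_span_def submodule_zero submodule_add submodule.smult_closed)

lemma mod_span_superset: "S \<subseteq> mod_span R M S"
  by (auto simp: mod_span_def)

lemma mod_span_least: "\<lbrakk>submodule N R M; S \<subseteq> N\<rbrakk> \<Longrightarrow> mod_span R M S \<subseteq> N"
  by (auto simp: mod_span_def)

context left_module
begin

text \<open>The projection to the quotient is a homomorphism and the socle is a span, so the
  preimage inherits closure. It contains \<open>N\<close> because all of \<open>N\<close> goes to
  the zero coset.\<close>

lemma submodule_socle_preimage:
  assumes N: "submodule N R M"
  shows "submodule {x \<in> carrier M. N +>\<^bsub>M\<^esub> x \<in> X_socle R \<X> (quot_module M N)} R M" (is "submodule ?H R M")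
    and "N \<subseteq> {x \<in> carrier M. N +>\<^bsub>M\<^esub> x \<in> X_socle R \<X> (quot_module M N)}"
proof -
  note pr = mod_homD[OF quot_proj_hom[OF N]]
  note cl = mod_span_closed[where M = "quot_module M N" and R = R]
  have zero: "N \<in> X_socle R \<X> (quot_module M N)"
    using cl(1) by (auto simp: X_socle_def quot_module_def)
  have coset: "N +>\<^bsub>M\<^esub> x = N" if "x \<in> N" for x
    using M.a_coset_join2[OF _ submodule.axioms(1)[OF N] that] submodule_subset[OF N] that by blast
  show sub: "N \<subseteq> ?H" using zero coset submodule_subset[OF N] by auto
  show "submodule ?H R M"
  proof (rule submoduleI)
    show "\<zero>\<^bsub>M\<^esub> \<in> ?H" using sub submodule_zero[OF N] by blast
    show "x \<oplus>\<^bsub>M\<^esub> y \<in> ?H" if "x \<in> ?H" "y \<in> ?H" for x y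
      using that cl(2) by (auto simp: pr(2) X_socle_def)
    show "a \<odot>\<^bsub>M\<^esub> x \<in> ?H" if "a \<in> carrier R" "x \<in> ?H" for a x
      using that cl(3) by (auto simp: pr(3) X_socle_def)
  qed auto
qed

lemma submodule_socle_stage: "submodule (socle_stage R \<X> M n) R M"
proof (induction n)
  case 0
  show ?case by (rule submoduleI) (auto simp: smult_zero_right)
next
  case (Suc n)
  then show ?case using submodule_socle_preimage(1) by simp
qed

lemma socle_stage_mono:
  assumes "m \<le> n" shows "socle_stage R \<X> M m \<subseteq> socle_stage R \<X> M n"
  using assms
proof (induction n rule: dec_induct)
  case (step n)
  have "socle_stage R \<X> M n \<subseteq> socle_stage R \<X> M (Suc n)"
    unfolding socle_stage.simps(2) by (rule submodule_socle_preimage(2)[OF submodule_socle_stage])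
  with step.IH show ?case by (rule subset_trans)
qed (rule subset_refl)

text \<open>The stages form an ascending chain, so finitely many elements fit into the largest of
  their stages. It will be applied to the images of the finitely many relations of a brick.\<close>

lemma finite_subset_socle_stage:
  assumes "finite S" "S \<subseteq> (\<Union>n. socle_stage R \<X> M n)"
  shows "\<exists>n. S \<subseteq> socle_stage R \<X> M n"
  using assms
proof (induction S)
  case (insert x S)
  then obtain m n where "S \<subseteq> socle_stage R \<X> M n" "x \<in> socle_stage R \<X> M m" by auto
  then have "insert x S \<subseteq> socle_stage R \<X> M (max m n)"
    using socle_stage_mono[of n "max m n"] socle_stage_mono[of m "max m n"] by fastforce
  then show ?case by blast
qed simp

section \<open>Lifting a finite presentation across one filtration factor\<close>

text \<open>The map is the projection B -> B/A followed by the given isomorphism. Describing it as a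
  surjection with kernel \<open>A\<close> removes cosets from the later argument.\<close>

lemma quot_iso_hom:
  assumes B: "submodule B R M" and A: "submodule A R M" and AB: "A \<subseteq> B"
    and X: "left_module R X" and iso: "mod_iso R (quot_module (M\<lparr>carrier := B\<rparr>) A) X"
  obtains h where "h \<in> mod_hom R (M\<lparr>carrier := B\<rparr>) X" "h ` B = carrier X"
    "\<And>x. x \<in> B \<Longrightarrow> h x = \<zero>\<^bsub>X\<^esub> \<Longrightarrow> x \<in> A" "\<And>x. x \<in> A \<Longrightarrow> h x = \<zero>\<^bsub>X\<^esub>"
proof -
  let ?B = "M\<lparr>carrier := B\<rparr>"
  let ?Q = "quot_module ?B A"
  interpret B: left_module R ?B using left_module_submodule[OF _ B] left_module_axioms by blast
  interpret X: left_module R X by (rule X)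
  obtain g where g: "g \<in> mod_hom R ?Q X" and bij: "bij_betw g (carrier ?Q) (carrier X)"
    using iso by (auto simp: mod_iso_def)
  have AB': "submodule A R ?B"
    by (rule B.submoduleI)
      (use AB in \<open>auto simp: submodule_zero[OF A] submodule_add[OF A] submodule.smult_closed[OF A]\<close>)
  note pr = mod_homD[OF B.quot_proj_hom[OF AB']]
  let ?h = "\<lambda>x. g (A +>\<^bsub>?B\<^esub> x)"
  have h: "?h \<in> mod_hom R ?B X"
    by (rule mod_homI) (use pr mod_homD[OF g] in auto)
  have Ain: "A +>\<^bsub>?B\<^esub> x = A" if "x \<in> A" for x
    using B.a_coset_join2[OF _ submodule.axioms(1)[OF AB'] that] AB that by auto
  \<comment> \<open>The coset \<open>A\<close> is the zero of the quotient. That \<open>g\<close>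
    preserves zero is derived from the composite \<open>?h\<close>, whose domain is known to be a
    module, by scaling with 0.\<close>
  have g0: "g A = \<zero>\<^bsub>X\<^esub>"
  proof -
    have z: "\<zero>\<^bsub>M\<^esub> \<in> A" using submodule_zero[OF A] .
    have "?h (\<zero>\<^bsub>R\<^esub> \<odot>\<^bsub>?B\<^esub> \<zero>\<^bsub>?B\<^esub>) = \<zero>\<^bsub>R\<^esub> \<odot>\<^bsub>X\<^esub> ?h \<zero>\<^bsub>?B\<^esub>"
      using mod_homD(3)[OF h, of "\<zero>\<^bsub>R\<^esub>" "\<zero>\<^bsub>?B\<^esub>"] B.zero_closed R.zero_closed by blast
    then show ?thesis
      using Ain[OF z] mod_homD(1)[OF h B.zero_closed] B.smult_zero_left[OF B.zero_closed]
        X.smult_zero_left[OF mod_homD(1)[OF h B.zero_closed]] by simp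
  qed
  show thesis
  proof (rule that[OF h])
    show "?h ` B = carrier X"
    proof -
      have "carrier ?Q = (\<lambda>x. A +>\<^bsub>?B\<^esub> x) ` B"
        by (auto simp: quot_module_def A_RCOSETS_def')
      then show ?thesis using bij_betw_imp_surj_on[OF bij] by (simp add: image_image)
    qed
    show "?h x = \<zero>\<^bsub>X\<^esub>" if "x \<in> A" for x
      using Ain[OF that] g0 by simp
    show "x \<in> A" if x: "x \<in> B" and hx: "?h x = \<zero>\<^bsub>X\<^esub>" for x
    proof -
      have "A \<in> carrier ?Q" using pr(1)[of "\<zero>\<^bsub>M\<^esub>"] Ain submodule_zero[OF A] submodule_zero[OF B] by simp
      then have "A +>\<^bsub>?B\<^esub> x = A"
        using bij_betw_imp_inj_on[OF bij] hx g0 pr(1)[of x] x by (intro inj_onD[of g]) auto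
      then show ?thesis
        using B.a_coset_join1[OF _ _ submodule.axioms(1)[OF AB'], of x] x by simp
    qed
  qed
qed

text \<open>Since \<open>f\<close> sends the kernel of \<open>p\<close> into \<open>N\<close>, it
  induces a homomorphism from X, the quotient of F by that kernel, to M/N. The image of such a map
  is among the generators of the socle.\<close>

lemma presentation_image_socle:
  assumes X: "X \<in> \<X>" "left_module R X" and N: "submodule N R M"
    and F: "left_module R F" and f: "f \<in> mod_hom R F M"
    and p: "p \<in> mod_hom R F X" "p ` carrier F = carrier X"
    and ker: "\<And>u. u \<in> carrier F \<Longrightarrow> p u = \<zero>\<^bsub>X\<^esub> \<Longrightarrow> f u \<in> N"
    and u: "u \<in> carrier F"
  shows "N +>\<^bsub>M\<^esub> f u \<in> X_socle R \<X> (quot_module M N)"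
proof -
  interpret F: left_module R F by (rule F)
  interpret X: left_module R X by (rule X(2))
  \<comment> \<open>\<open>q\<close> is the induced map, computed on a chosen preimage under
    \<open>p\<close>. Two preimages differ by an element of the kernel, so the coset does not depend
    on the choice.\<close>
  define q where "q x = N +>\<^bsub>M\<^esub> f (SOME v. v \<in> carrier F \<and> p v = x)" for x
  have fc: "f v \<in> carrier M" if "v \<in> carrier F" for v using mod_homD(1)[OF f that] .
  note pr = mod_homD[OF quot_proj_hom[OF N]]
  \<comment> \<open>Stated for an arbitrary target module because it is used both for
    \<open>p\<close> into X and for \<open>f\<close> into M.\<close>
  have sub: "g (v \<ominus>\<^bsub>F\<^esub> w) = g v \<ominus>\<^bsub>L\<^esub> g w"
    if "v \<in> carrier F" "w \<in> carrier F" "g \<in> mod_hom R F L" "left_module R L" for g v w and L :: "('r, 'z) module"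
  proof -
    interpret L: left_module R L by fact
    have "g (\<ominus>\<^bsub>F\<^esub> w) = \<ominus>\<^bsub>L\<^esub> g w"
      using mod_homD(3)[OF that(3), of "\<ominus>\<^bsub>R\<^esub> \<one>\<^bsub>R\<^esub>" w] that(2) F.smult_minus_one[of w]
        L.smult_minus_one[of "g w"] mod_homD(1)[OF that(3), of w] by simp
    then show ?thesis using mod_homD(2)[OF that(3)] that by (simp add: a_minus_def)
  qed
  have q: "q (p v) = N +>\<^bsub>M\<^esub> f v" if v: "v \<in> carrier F" for v
  proof -
    define w where "w = (SOME w. w \<in> carrier F \<and> p w = p v)"
    have w: "w \<in> carrier F \<and> p w = p v"
      unfolding w_def by (rule someI[of _ v]) (use v in simp)
    have "p (w \<ominus>\<^bsub>F\<^esub> v) = \<zero>\<^bsub>X\<^esub>"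
      using sub[OF _ v p(1) X(2), of w] w mod_homD(1)[OF p(1) v] by (simp add: a_minus_def X.r_neg)
    then have "f (w \<ominus>\<^bsub>F\<^esub> v) \<in> N" using ker[of "w \<ominus>\<^bsub>F\<^esub> v"] w v by simp
    then have "f w \<ominus>\<^bsub>M\<^esub> f v \<in> N" using sub[OF _ v f left_module_axioms, of w] w by simp
    then have "N +>\<^bsub>M\<^esub> f w = N +>\<^bsub>M\<^esub> f v" using rcoset_eq_iff[OF N] fc v w by blast
    then show ?thesis by (simp add: q_def w_def)
  qed
  have surj: "\<exists>v\<in>carrier F. x = p v" if "x \<in> carrier X" for x using that p(2) by blast
  have "q \<in> mod_hom R X (quot_module M N)"
  proof (rule mod_homI)
    show "q x \<in> carrier (quot_module M N)" if "x \<in> carrier X" for x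
      using surj[OF that] q pr(1) fc by auto
    show "q (x \<oplus>\<^bsub>X\<^esub> y) = q x \<oplus>\<^bsub>quot_module M N\<^esub> q y" if x: "x \<in> carrier X" and y: "y \<in> carrier X" for x y
    proof -
      obtain v w where vw: "v \<in> carrier F" "w \<in> carrier F" "x = p v" "y = p w"
        using surj[OF x] surj[OF y] by blast
      then have "q (x \<oplus>\<^bsub>X\<^esub> y) = N +>\<^bsub>M\<^esub> f (v \<oplus>\<^bsub>F\<^esub> w)"
        using q[of "v \<oplus>\<^bsub>F\<^esub> w"] mod_homD(2)[OF p(1) vw(1,2)] by simp
      also have "\<dots> = (N +>\<^bsub>M\<^esub> f v) \<oplus>\<^bsub>quot_module M N\<^esub> (N +>\<^bsub>M\<^esub> f w)"
        by (simp only: mod_homD(2)[OF f vw(1,2)] pr(2)[OF fc fc, OF vw(1,2)])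
      finally show ?thesis by (simp only: vw(3,4) q[OF vw(1)] q[OF vw(2)])
    qed
    show "q (a \<odot>\<^bsub>X\<^esub> x) = a \<odot>\<^bsub>quot_module M N\<^esub> q x" if a: "a \<in> carrier R" and x: "x \<in> carrier X" for a x
    proof -
      obtain v where v: "v \<in> carrier F" "x = p v" using surj[OF x] by blast
      then have "q (a \<odot>\<^bsub>X\<^esub> x) = N +>\<^bsub>M\<^esub> f (a \<odot>\<^bsub>F\<^esub> v)"
        using q[of "a \<odot>\<^bsub>F\<^esub> v"] mod_homD(3)[OF p(1) a v(1)] a by simp
      also have "\<dots> = a \<odot>\<^bsub>quot_module M N\<^esub> (N +>\<^bsub>M\<^esub> f v)"
        by (simp only: mod_homD(3)[OF f a v(1)] pr(3)[OF a fc, OF v(1)])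
      finally show ?thesis by (simp only: v(2) q[OF v(1)])
    qed
  qed
  then have "q (p u) \<in> (\<Union>X\<in>\<X>. \<Union>f\<in>mod_hom R X (quot_module M N). f ` carrier X)"
    using X(1) mod_homD(1)[OF p(1) u] by blast
  then show ?thesis
    unfolding X_socle_def q[OF u] by (rule subsetD[OF mod_span_superset])
qed

text \<open>This is the successor step. A lift of the presentation covers B only up to elements of
  A, and both contributions lie in finite stages.\<close>

lemma extension_subset_socle_stages:
  assumes B: "submodule B R M" and A: "submodule A R M" and AB: "A \<subseteq> B"
    and X: "X \<in> \<X>" "left_module R X" "fin_presented R X"
    and iso: "mod_iso R (quot_module (M\<lparr>carrier := B\<rparr>) A) X"
    and stages: "A \<subseteq> (\<Union>n. socle_stage R \<X> M n)"
  shows "B \<subseteq> (\<Union>n. socle_stage R \<X> M n)"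
proof
  let ?B = "M\<lparr>carrier := B\<rparr>"
  interpret B: left_module R ?B using left_module_submodule[OF _ B] left_module_axioms by blast
  interpret X: left_module R X by (rule X(2))
  obtain h where h: "h \<in> mod_hom R ?B X" "h ` B = carrier X"
    "\<And>x. x \<in> B \<Longrightarrow> h x = \<zero>\<^bsub>X\<^esub> \<Longrightarrow> x \<in> A" "\<And>x. x \<in> A \<Longrightarrow> h x = \<zero>\<^bsub>X\<^esub>"
    using quot_iso_hom[OF B A AB X(2) iso] by blast
  obtain n p S where p: "p \<in> mod_hom R (free_module R {..<n::nat}) X"
      "p ` carrier (free_module R {..<n}) = carrier X"
    and S: "finite S" "S \<subseteq> carrier (free_module R {..<n})"
    and ker: "a_kernel (free_module R {..<n}) X p = mod_span R (free_module R {..<n}) S"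
    using X(3) by (auto simp: fin_presented_def)
  let ?F = "free_module R {..<n}"
  have lF: "left_module R ?F" by (rule left_module_free) (rule R.ring_axioms)
  have "\<exists>y\<in>B. h y = p (unit_vec R i)" if "i < n" for i
    using that h(2) mod_homD(1)[OF p(1) unit_vec_carrier[OF R.ring_axioms]] by (metis imageE lessThan_iff)
  \<comment> \<open>The \<open>m i\<close> are preimages in \<open>B\<close> of the generators of X;
    freeness extends this choice to the lift \<open>f\<close>.\<close>
  then obtain m where m: "\<And>i. i < n \<Longrightarrow> m i \<in> B \<and> h (m i) = p (unit_vec R i)" by metis
  obtain f where f: "f \<in> mod_hom R ?F ?B" "\<And>i. i < n \<Longrightarrow> f (unit_vec R i) = m i"
    using B.free_hom_exists[of "{..<n}" m] m by auto
  have fB: "f u \<in> B" if "u \<in> carrier ?F" for u using mod_homD(1)[OF f(1) that] by simp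
  have fM: "f \<in> mod_hom R ?F M"
    using mod_homD[OF f(1)] submodule_subset[OF B] by (intro mod_homI) auto
  have "(\<lambda>u. h (f u)) \<in> mod_hom R ?F X"
    using mod_homD[OF f(1)] mod_homD[OF h(1)] by (intro mod_homI) auto
  \<comment> \<open>Both maps agree on the unit vectors, hence everywhere.\<close>
  then have hf: "h (f u) = p u" if "u \<in> carrier ?F" for u
    using free_hom_eqI[OF R.ring_axioms X(2) _ p(1) _ that] f(2) m by auto
  have "f ` S \<subseteq> A"
  proof -
    have "p s = \<zero>\<^bsub>X\<^esub>" if "s \<in> S" for s
      using that mod_span_superset[of S R ?F] ker by (auto simp: a_kernel_def')
    then show ?thesis using h(3)[OF fB] hf S(2) by (auto simp: subset_iff)
  qed
  then obtain k where k: "f ` S \<subseteq> socle_stage R \<X> M k"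
    using finite_subset_socle_stage[of "f ` S"] S(1) stages by blast
  let ?W = "socle_stage R \<X> M"
  \<comment> \<open>The preimage of stage \<open>k\<close> under \<open>f\<close> is a submodule.
    Containing the relations \<open>S\<close>, it contains the whole kernel of
    \<open>p\<close>.\<close>
  have "mod_span R ?F S \<subseteq> {u \<in> carrier ?F. f u \<in> ?W k}"
    using submodule_vimage[OF lF fM submodule_socle_stage, of \<X> k] k S(2)
    by (intro mod_span_least) auto
  then have kerW: "f u \<in> ?W k" if "u \<in> carrier ?F" "p u = \<zero>\<^bsub>X\<^esub>" for u
    using ker that by (auto simp: a_kernel_def')
  have img: "f u \<in> ?W (Suc k)" if u: "u \<in> carrier ?F" for u
    using presentation_image_socle[OF X(1,2) submodule_socle_stage lF fM p kerW u] mod_homD(1)[OF fM u]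
    by simp
  fix y assume y: "y \<in> B"
  then obtain u where u: "u \<in> carrier ?F" "h y = p u" using h(2) p(2) by (metis imageE imageI)
  have yM: "y \<in> carrier M" and fuM: "f u \<in> carrier M" using y fB[OF u(1)] submodule_subset[OF B] by auto
  \<comment> \<open>The correction term: \<open>h\<close> takes the same value at \<open>y\<close>
    and at \<open>f u\<close>, so it kills \<open>d\<close>, and therefore \<open>d\<close> lies in
    \<open>A\<close>.\<close>
  define d where "d = y \<ominus>\<^bsub>M\<^esub> f u"
  have dB: "d \<in> B" unfolding d_def using submodule_minus[OF B y fB[OF u(1)]] .
  have yd: "y = d \<oplus>\<^bsub>M\<^esub> f u" unfolding d_def using yM fuM by (simp add: a_minus_def M.a_assoc M.l_neg)
  have "h y = h d \<oplus>\<^bsub>X\<^esub> h (f u)" using mod_homD(2)[OF h(1), of d "f u"] dB fB[OF u(1)] yd by simp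
  then have "h d = \<zero>\<^bsub>X\<^esub>"
    using u(2) hf[OF u(1)] mod_homD(1)[OF h(1)] dB mod_homD(1)[OF p(1) u(1)]
    by (simp add: X.add.l_cancel_one')
  then obtain j where "d \<in> ?W j" using h(3)[OF dB] stages by blast
  then have "d \<in> ?W (max j (Suc k))" using socle_stage_mono[of j "max j (Suc k)" \<X>] by auto
  moreover have "f u \<in> ?W (max j (Suc k))"
    using img[OF u(1)] socle_stage_mono[of "Suc k" "max j (Suc k)" \<X>] by auto
  ultimately show "y \<in> (\<Union>n. ?W n)"
    using yd submodule_add[OF submodule_socle_stage] by blast
qed

end

section \<open>Ordinals\<close>

lemma ordinal_cases:
  assumes "a \<in> Field r"
  obtains "is_zero r a" | b where "is_succ r b a" | "is_limit r a"
  using assms unfolding is_limit_def by blast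

text \<open>By totality nothing lies strictly between \<open>b\<close> and its successor
  \<open>a\<close>. So passing to a successor adds exactly one predecessor, matching the recursion
  of \<open>socle_stage\<close>.\<close>

lemma is_succ_underS:
  assumes "Well_order r" and "is_succ r b a"
  shows "underS r a = insert b (underS r b)" "b \<in> Field r"
proof -
  have ba: "b \<noteq> a" "(b, a) \<in> r" and least: "\<And>c. b \<noteq> c \<Longrightarrow> (b, c) \<in> r \<Longrightarrow> (a, c) \<in> r"
    using assms(2) by (auto simp: is_succ_def aboveS_def)
  interpret W: wo_rel r using assms(1) by (simp add: wo_rel_def)
  show bF: "b \<in> Field r" using ba by (auto simp: Field_def)
  show "underS r a = insert b (underS r b)"
  proof (intro equalityI subsetI)
    fix c assume c: "c \<in> underS r a"
    then have cF: "c \<in> Field r" and ca: "c \<noteq> a" "(c, a) \<in> r" by (auto simp: underS_def Field_def)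
    have "\<not> (b \<noteq> c \<and> (b, c) \<in> r)"
      using least[of c] ca W.ANTISYM by (auto simp: antisym_def)
    then show "c \<in> insert b (underS r b)"
      using W.TOTALS cF bF by (auto simp: underS_def)
  next
    fix c assume "c \<in> insert b (underS r b)"
    then show "c \<in> underS r a"
      using ba W.TRANS W.ANTISYM by (auto simp: underS_def trans_def antisym_def)
  qed
qed

text \<open>Of two distinct positions, the smaller has a strictly smaller initial segment. The
  number of predecessors thus identifies the finite positions with natural numbers, which also gives
  countability.\<close>

lemma underS_card_inj:
  assumes "Well_order r"
  shows "inj_on (\<lambda>a. card (underS r a)) {a \<in> Field r. finite (underS r a)}"
proof (rule inj_onI)
  interpret W: wo_rel r using assms by (simp add: wo_rel_def)
  have less: "card (underS r a) < card (underS r b)"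
    if "finite (underS r b)" "(a, b) \<in> r" "a \<noteq> b" for a b
  proof (rule psubset_card_mono[OF that(1)])
    have "a \<in> underS r b" "a \<notin> underS r a" using that by (auto simp: underS_def)
    moreover have "underS r a \<subseteq> underS r b"
      using that W.TRANS W.ANTISYM by (auto simp: underS_def trans_def antisym_def)
    ultimately show "underS r a \<subset> underS r b" by blast
  qed
  fix a b assume a: "a \<in> {a \<in> Field r. finite (underS r a)}" and b: "b \<in> {a \<in> Field r. finite (underS r a)}"
    and eq: "card (underS r a) = card (underS r b)"
  show "a = b"
  proof (rule ccontr)
    assume ne: "a \<noteq> b"
    have "(a, b) \<in> r \<or> (b, a) \<in> r" using a b W.TOTALS by auto
    then show False using less[of b a] less[of a b] a b ne eq by auto
  qed
qed

text \<open>Used to exclude limits with finitely many predecessors: the largest predecessor would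
  make the position a successor.\<close>

lemma finite_subset_has_max:
  assumes "Well_order r" "finite S" "S \<noteq> {}" "S \<subseteq> Field r"
  shows "\<exists>b\<in>S. \<forall>c\<in>S. (c, b) \<in> r"
proof -
  interpret W: wo_rel r using assms(1) by (simp add: wo_rel_def)
  from assms(2,3,4) show ?thesis
  proof (induction S rule: finite_ne_induct)
    case (singleton x)
    then show ?case using W.REFL by (auto simp: refl_on_def)
  next
    case (insert x S)
    then obtain b where b: "b \<in> S" "\<forall>c\<in>S. (c, b) \<in> r" by auto
    show ?case
    proof (cases "(x, b) \<in> r")
      case True
      then show ?thesis using b by blast
    next
      case False
      then have "(b, x) \<in> r" "(x, x) \<in> r" using W.TOTALS W.REFL insert.prems b(1) by (auto simp: refl_on_def)
      then show ?thesis using b W.TRANS by (metis insert_iff transD)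
    qed
  qed
qed

section \<open>Concrete well-orders on the natural numbers\<close>

lemma is_succ_natLeq_on: "is_succ (natLeq_on k) a b \<longleftrightarrow> b = Suc a \<and> b < k"
proof
  assume s: "is_succ (natLeq_on k) a b"
  then have b: "a < b" "b < k" by (auto simp: is_succ_def aboveS_def)
  then have "Suc a \<in> aboveS (natLeq_on k) a" by (auto simp: aboveS_def)
  then have "(b, Suc a) \<in> natLeq_on k" using s unfolding is_succ_def by blast
  then show "b = Suc a \<and> b < k" using b by auto
qed (auto simp: is_succ_def aboveS_def)

text \<open>The ordinal \<open>\<omega> + 1\<close> on the natural numbers, with 0 moved to the top.\<close>

definition omega_plus_one :: "nat rel" where
  "omega_plus_one = {(a, b). b = 0 \<or> 0 < a \<and> a \<le> b}"

lemma Field_omega_plus_one: "Field omega_plus_one = UNIV"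
proof -
  have "(a, 0) \<in> omega_plus_one" for a by (simp add: omega_plus_one_def)
  then show ?thesis using FieldI1 by fast
qed

lemma Well_order_omega_plus_one: "Well_order omega_plus_one"
proof -
  \<comment> \<open>The first component of the key puts 0 above every positive number; the second
    compares positive numbers by size.\<close>
  have "omega_plus_one - Id \<subseteq> inv_image (less_than <*lex*> less_than) (\<lambda>a. (if a = 0 then 1 else 0, a))"
    by (auto simp: omega_plus_one_def split: if_splits)
  then have "wf (omega_plus_one - Id)"
    by (rule wf_subset[rotated]) (intro wf_inv_image wf_lex_prod wf_less_than)
  moreover have "Linear_order omega_plus_one"
    unfolding linear_order_on_def partial_order_on_def preorder_on_def Field_omega_plus_one
    by (auto simp: omega_plus_one_def refl_on_def trans_def antisym_def total_on_def)
  ultimately show ?thesis by (simp add: well_order_on_def)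
qed

text \<open>The top element 0 has no successor, and it is not one either, since \<open>Suc a\<close>
  is never 0. Hence the top is a limit.\<close>

lemma is_succ_omega_plus_one: "is_succ omega_plus_one a b \<longleftrightarrow> 0 < a \<and> b = Suc a"
proof
  assume s: "is_succ omega_plus_one a b"
  then have b: "b \<noteq> a" "(a, b) \<in> omega_plus_one" by (auto simp: is_succ_def aboveS_def)
  have a: "0 < a" using b by (auto simp: omega_plus_one_def)
  then have "Suc a \<in> aboveS omega_plus_one a" by (auto simp: aboveS_def omega_plus_one_def)
  then have "(b, Suc a) \<in> omega_plus_one" using s unfolding is_succ_def by blast
  then show "0 < a \<and> b = Suc a" using a b by (auto simp: omega_plus_one_def)
qed (auto simp: is_succ_def aboveS_def omega_plus_one_def)

section \<open>Length of the socle filtration\<close>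

lemma (in left_module) Filt_socle_stages:
  assumes filt: "X_filtration R \<X> M r \<mu> F" and bricks: "\<And>X. X \<in> \<X> \<Longrightarrow> brick R X"
  shows "carrier M = (\<Union>n. socle_stage R \<X> M n)"
proof
  have F: "filtration R M r \<mu> F"
    and succ: "\<And>a b. is_succ r a b \<Longrightarrow> \<exists>X\<in>\<X>. mod_iso R (quot_module (M\<lparr>carrier := F b\<rparr>) (F a)) X"
    using filt by (auto simp: X_filtration_def)
  have wo: "Well_order r" and \<mu>: "\<mu> \<in> Field r"
    using F by (auto simp: filtration_def ordinal_segment_def)
  interpret W: wo_rel r using wo by (simp add: wo_rel_def)
  have "a \<in> Field r \<longrightarrow> F a \<subseteq> (\<Union>n. socle_stage R \<X> M n)" for a
  proof (induction a rule: W.well_order_induct)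
    case (1 a)
    show ?case
    proof
      assume a: "a \<in> Field r"
      have IH: "F b \<subseteq> (\<Union>n. socle_stage R \<X> M n)" if "b \<in> underS r a" for b
        using 1 that by (auto simp: underS_def Field_def)
      from a show "F a \<subseteq> (\<Union>n. socle_stage R \<X> M n)"
      proof (cases rule: ordinal_cases)
        case 1
        then have "F a = socle_stage R \<X> M 0" using F by (simp add: filtration_def)
        then show ?thesis by blast
      next
        case (2 b)
        have ba: "(b, a) \<in> r" "b \<in> underS r a" "b \<in> Field r"
          using is_succ_underS[OF wo 2] by (auto simp: underS_def)
        obtain X where X: "X \<in> \<X>" "mod_iso R (quot_module (M\<lparr>carrier := F a\<rparr>) (F b)) X"
          using succ[OF 2] by blast
        have "submodule (F a) R M" "submodule (F b) R M" "F b \<subseteq> F a"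
          using F a ba by (auto simp: filtration_def)
        then show ?thesis
          using extension_subset_socle_stages[OF _ _ _ X(1) _ _ X(2) IH[OF ba(2)]] bricks[OF X(1)]
          by (auto simp: brick_def)
      next
        case 3
        then show ?thesis using F IH by (auto simp: filtration_def)
      qed
    qed
  qed
  then have "F \<mu> \<subseteq> (\<Union>n. socle_stage R \<X> M n)" using \<mu> by blast
  then show "carrier M \<subseteq> (\<Union>n. socle_stage R \<X> M n)"
    using F by (simp add: filtration_def)
  show "(\<Union>n. socle_stage R \<X> M n) \<subseteq> carrier M"
    using submodule_subset[OF submodule_socle_stage] by blast
qed

text \<open>The recursion forces \<open>V\<close> to agree with the finite stages wherever there are
  finitely many predecessors. The first position beyond these is a limit where \<open>V\<close> is
  already all of M, so by minimality of the length it cannot lie strictly below \<mu>.\<close>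

lemma (in left_module) X_socle_filtration_countable:
  assumes V: "X_socle_filtration R \<X> M r \<mu> V"
    and stages: "carrier M = (\<Union>n. socle_stage R \<X> M n)"
  shows "countable (underS r \<mu>)"
proof -
  have wo: "Well_order r" and \<mu>: "\<mu> \<in> Field r"
    using V by (auto simp: X_socle_filtration_def ordinal_segment_def)
  interpret W: wo_rel r using wo by (simp add: wo_rel_def)
  let ?A = "{a \<in> Field r. finite (underS r a)}"
  have stage: "a \<in> ?A \<longrightarrow> V a = socle_stage R \<X> M (card (underS r a))" for a
  proof (induction a rule: W.well_order_induct)
    case (1 a)
    show ?case
    proof
      assume a: "a \<in> ?A"
      then have "a \<in> Field r" by simp
      then show "V a = socle_stage R \<X> M (card (underS r a))"
      proof (cases rule: ordinal_cases)
        case 1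
        then show ?thesis using V by (simp add: X_socle_filtration_def is_zero_def)
      next
        case (2 b)
        note u = is_succ_underS[OF wo 2]
        have "b \<in> underS r a" using u by blast
        then have "V b = socle_stage R \<X> M (card (underS r b))"
          using 1 a u by (auto simp: underS_def)
        moreover have "card (underS r a) = Suc (card (underS r b))"
          using u(1) a by (simp add: underS_def)
        ultimately show ?thesis using V 2 by (simp add: X_socle_filtration_def)
      next
        case 3
        \<comment> \<open>This cannot happen: the largest element of \<open>underS r a\<close> would be a predecessor of \<open>a\<close>.\<close>
        have ne: "underS r a \<noteq> {}" using 3 by (auto simp: is_limit_def is_zero_def)
        have sub: "underS r a \<subseteq> Field r" by (auto simp: underS_def Field_def)
        have "\<exists>b\<in>underS r a. \<forall>c\<in>underS r a. (c, b) \<in> r"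
          using finite_subset_has_max[OF wo _ ne sub] a by simp
        then obtain b where b: "b \<in> underS r a" "\<And>c. c \<in> underS r a \<Longrightarrow> (c, b) \<in> r" by blast
        have "is_succ r b a"
          unfolding is_succ_def
        proof
          show "a \<in> aboveS r b" using b(1) by (auto simp: aboveS_def underS_def)
          show "\<forall>c\<in>aboveS r b. (a, c) \<in> r"
          proof
            fix c assume c: "c \<in> aboveS r b"
            then have "c \<in> Field r" "c \<notin> underS r a"
              using b(2)[of c] W.ANTISYM by (auto simp: aboveS_def Field_def antisym_def)
            then show "(a, c) \<in> r" using W.TOTALS W.REFL a by (auto simp: underS_def refl_on_def)
          qed
        qed
        then show ?thesis using 3 by (auto simp: is_limit_def)
      qed
    qed
  qed
  \<comment> \<open>Otherwise take the least position \<open>a\<close> below \<mu> with infinitely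
    many predecessors.\<close>
  have "underS r \<mu> \<subseteq> ?A"
  proof (rule ccontr)
    assume "\<not> underS r \<mu> \<subseteq> ?A"
    then have ne: "{a \<in> underS r \<mu>. infinite (underS r a)} \<noteq> {}"
      by (auto simp: underS_def Field_def)
    let ?I = "{a \<in> underS r \<mu>. infinite (underS r a)}"
    have "?I \<subseteq> Field r" by (auto simp: underS_def Field_def)
    then obtain a where a: "a \<in> ?I" and least: "\<And>b. b \<in> ?I \<Longrightarrow> (a, b) \<in> r"
      using W.minim_in[of ?I] W.minim_least[of ?I] ne by blast
    have below: "underS r a \<subseteq> ?A"
    proof
      fix b assume b: "b \<in> underS r a"
      then have "b \<in> underS r \<mu>" using a W.TRANS W.ANTISYM by (auto simp: underS_def trans_def antisym_def)
      moreover have "(a, b) \<notin> r" using b W.ANTISYM by (auto simp: underS_def antisym_def)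
      ultimately show "b \<in> ?A" using least[of b] by (auto simp: underS_def Field_def)
    qed
    have "a \<in> Field r" using a by (auto simp: underS_def Field_def)
    \<comment> \<open>A predecessor \<open>b\<close> with successor \<open>a\<close> would have
      finitely many predecessors, and then so would \<open>a\<close>.\<close>
    then have "is_limit r a"
    proof (cases rule: ordinal_cases)
      case 1
      then show ?thesis using a by (simp add: is_zero_def)
    next
      case (2 b)
      then show ?thesis using is_succ_underS[OF wo 2] a below by auto
    qed
    then have Va: "V a = (\<Union>b\<in>underS r a. V b)" using V by (simp add: X_socle_filtration_def)
    have "carrier M \<subseteq> V a"
    proof
      fix x assume "x \<in> carrier M"
      then obtain n where n: "x \<in> socle_stage R \<X> M n" using stages by blast
      \<comment> \<open>Distinct finite positions have distinct numbers of predecessors. These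
        numbers are therefore unbounded, and some position below \<open>a\<close> carries a stage
        beyond \<open>n\<close>.\<close>
      have "infinite ((\<lambda>b. card (underS r b)) ` underS r a)"
        using finite_imageD inj_on_subset[OF underS_card_inj[OF wo] below] a by blast
      then obtain b where b: "b \<in> underS r a" "n < card (underS r b)"
        unfolding infinite_nat_iff_unbounded by blast
      then have "x \<in> V b"
        using n stage[of b] below socle_stage_mono[of n "card (underS r b)" \<X>] by auto
      then show "x \<in> V a" using b(1) Va by blast
    qed
    moreover have "V a \<subseteq> carrier M"
      using Va below stage submodule_subset[OF submodule_socle_stage] by blast
    ultimately show False using a V by (auto simp: X_socle_filtration_def)
  qed
  moreover have "countable ?A"
    using underS_card_inj[OF wo] by (rule countableI)
  ultimately show ?thesis by (rule countable_subset)
qed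

section \<open>Existence of a socle filtration indexed by natural numbers\<close>

text \<open>Length \<open>n\<close> requires the \<open>n + 1\<close> positions 0 to n, hence
  \<open>natLeq_on (Suc n)\<close>. Each of them is zero or a successor, so the limit clause is
  vacuous.\<close>

lemma socle_stage_filtration_finite:
  assumes "socle_stage R \<X> M n = carrier M" "\<And>k. k < n \<Longrightarrow> socle_stage R \<X> M k \<noteq> carrier M"
  shows "X_socle_filtration R \<X> M (natLeq_on (Suc n)) n (socle_stage R \<X> M)"
proof -
  have F: "Field (natLeq_on (Suc n)) = {..n}" by (auto simp: Field_def)
  have zero: "is_zero (natLeq_on (Suc n)) a \<longleftrightarrow> a = 0" for a
    unfolding is_zero_def F by (auto simp: underS_def)
  have "\<not> is_limit (natLeq_on (Suc n)) a" for a
    unfolding is_limit_def zero unfolding F is_succ_natLeq_on by (cases a) auto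
  then show ?thesis
    unfolding X_socle_filtration_def ordinal_segment_def F zero is_succ_natLeq_on
    using natLeq_on_Well_order[of "Suc n", unfolded F] assms by (auto simp: underS_def)
qed

text \<open>The index shift comes from writing the top of \<open>omega_plus_one\<close> as 0:
  position \<open>Suc n\<close> carries stage \<open>n\<close>. The top is the only limit, where
  \<open>stages\<close> supplies the union, and \<open>proper\<close> gives minimality of the
  length.\<close>

lemma (in left_module) socle_stage_filtration_omega:
  assumes stages: "carrier M = (\<Union>n. socle_stage R \<X> M n)"
    and proper: "\<And>n. socle_stage R \<X> M n \<noteq> carrier M"
  shows "X_socle_filtration R \<X> M omega_plus_one 0
           (\<lambda>a. case a of 0 \<Rightarrow> carrier M | Suc n \<Rightarrow> socle_stage R \<X> M n)" (is "X_socle_filtration _ _ _ _ _ ?V")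
proof -
  have zero: "is_zero omega_plus_one a \<longleftrightarrow> a = 1" for a
  proof
    assume "is_zero omega_plus_one a"
    then have "\<not> 1 \<in> underS omega_plus_one a" by (simp add: is_zero_def)
    then show "a = 1" by (cases a) (auto simp: underS_def omega_plus_one_def)
  next
    assume "a = 1"
    then show "is_zero omega_plus_one a"
      unfolding is_zero_def Field_omega_plus_one by (auto simp: underS_def omega_plus_one_def)
  qed
  have limit: "a = 0" if "is_limit omega_plus_one a" for a
  proof (rule ccontr)
    assume "a \<noteq> 0"
    then have "a = 1 \<or> is_succ omega_plus_one (a - 1) a" by (auto simp: is_succ_omega_plus_one)
    then show False using that zero by (auto simp: is_limit_def)
  qed
  have under: "underS omega_plus_one 0 = range Suc"
    using not0_implies_Suc by (auto simp: underS_def omega_plus_one_def)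
  have "ordinal_segment omega_plus_one 0"
    using Well_order_omega_plus_one
    by (simp add: ordinal_segment_def Field_omega_plus_one) (simp add: omega_plus_one_def)
  moreover have "?V a = (\<Union>b\<in>underS omega_plus_one a. ?V b)" if "is_limit omega_plus_one a" for a
    using limit[OF that] under stages by simp
  moreover have "?V b = {x \<in> carrier M. ?V a +>\<^bsub>M\<^esub> x \<in> X_socle R \<X> (quot_module M (?V a))}"
    if "is_succ omega_plus_one a b" for a b
    using that unfolding is_succ_omega_plus_one by (cases a) auto
  ultimately show ?thesis
    unfolding X_socle_filtration_def zero using under proper by auto
qed

text \<open>The first conjunct guarantees that the process reaches M, so that a length exists;
  \<open>nat\<close> suffices as index type because the length is at most \<omega>. The second
  bounds that length for every representing well-order, whatever its type.\<close>

theorem corollary6p6: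
  fixes R :: "('r, 'c) ring_scheme"
    and \<X> :: "('r, 'x) module set"
    and M :: "('r, 'm) module"
  assumes "ring R"
    and "semibrick R \<X>"
    and "\<And>X. X \<in> \<X> \<Longrightarrow> proj_dim_le_one R X"
    and "\<And>X. X \<in> \<X> \<Longrightarrow> \<not> divisible_module R \<X> X"
    and "M \<in> Filt TYPE('i) R \<X>"
  shows "(\<exists>(r :: nat rel) \<mu> V. X_socle_filtration R \<X> M r \<mu> V) \<and>
         (\<forall>(r :: 'j rel) \<mu> V. X_socle_filtration R \<X> M r \<mu> V \<longrightarrow> countable (underS r \<mu>))"
proof -
  obtain r :: "'i rel" and \<mu> F where M: "left_module R M" and F: "X_filtration R \<X> M r \<mu> F"
    using assms(5) by (auto simp: Filt_def)
  interpret left_module R M by (rule M)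
  have stages: "carrier M = (\<Union>n. socle_stage R \<X> M n)"
    using Filt_socle_stages[OF F] assms(2) by (simp add: semibrick_def)
  have "\<exists>(r :: nat rel) \<mu> V. X_socle_filtration R \<X> M r \<mu> V"
  proof (cases "\<exists>n. socle_stage R \<X> M n = carrier M")
    case True
    \<comment> \<open>The least such \<open>n\<close> is taken because the length demands that no
      earlier stage equals M.\<close>
    then obtain n where "socle_stage R \<X> M n = carrier M"
      "\<And>k. k < n \<Longrightarrow> socle_stage R \<X> M k \<noteq> carrier M"
      using exists_least_iff[of "\<lambda>n. socle_stage R \<X> M n = carrier M"] by blast
    then show ?thesis using socle_stage_filtration_finite by blast
  next
    case False
    then show ?thesis using socle_stage_filtration_omega[OF stages] by blast
  qed
  then show ?thesis using X_socle_filtration_countable[OF _ stages] by auto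
qed

end
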